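(* Let $n\ge 2$ and let $F$ be the cumulative distribution function of a probability distribution on $(0,\infty)^n$ such that $F\in C^2((0,\infty)^n)$, $F$ is strict MTP$_2$, and the distribution has a probability density function $f$ that is everywhere positive on $(0,\infty)^n$. Let $\varnothing\neq I_1\subsetneq\{1,\dots,n\}$ and $I_2=\{1,\dots,n\}\setminus I_1$. For $\mathbf{x}\in(0,\infty)^n$ write $\mathbf{x}=\mathbf{x}_1\oplus\mathbf{x}_2$ with $\mathbf{x}_i=(x_k)_{k\in I_i}$, let $F_i$ be the marginal cumulative distribution function of $F$ belonging to the coordinates in $I_i$, $i=1,2$, and put $$r(\mathbf{x})=\frac{F(\mathbf{x})}{F_1(\mathbf{x}_1)F_2(\mathbf{x}_2)} .$$ Then for all $m\in\mathbb{N}$ with $m\ge 2$ and all $\mathbf{x}\in(0,\infty)^n$, the $m$-fold convolutions satisfy $$F^{m*}(\mathbf{x})>(r(\mathbf{x}))^m\,F_1^{m*}(\mathbf{x}_1)\,F_2^{m*}(\mathbf{x}_2),\qquad\text{with } r(\mathbf{x})>1,$$ and consequently, for every $\mathbf{b}\in(0,\infty)^n$, $$F^{m*}(\mathbf{x})>(r(\mathbf{b}))^m\,F_1^{m*}(\mathbf{x}_1)\,F_2^{m*}(\mathbf{x}_2)$$ for all $\mathbf{x}\in(0,\infty)^n$ with $\mathbf{x}\le\mathbf{b}$.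
   Context: MTP$_2$ means "multivariate totally positive of order 2": a function $F\ge 0$ on $(0,\infty)^n$ is MTP$_2$ if $F(\mathbf{x}\vee\mathbf{y})\,F(\mathbf{x}\wedge\mathbf{y})\ge F(\mathbf{x})F(\mathbf{y})$ for all $\mathbf{x},\mathbf{y}$, where $\vee$ and $\wedge$ are the componentwise maximum and minimum. For a cumulative distribution function $F\in C^2((0,\infty)^n)$ that is positive on $(0,\infty)^n$, strict MTP$_2$ means $$\frac{\partial^2}{\partial x_j\,\partial x_i}\log F(\mathbf{x})>0\quad\text{for all } i\neq j \text{ and all } \mathbf{x}\in(0,\infty)^n .$$ If $F$ is the cumulative distribution function of a random vector $(X_1,\dots,X_n)$, i.e. $F(\mathbf{x})=P(X_1\le x_1,\dots,X_n\le x_n)$, then $F_i(\mathbf{x}_i)=P(X_k\le x_k \text{ for all } k\in I_i)$, $i=1,2$. For a cumulative distribution function $G$ of a random vector, $G^{m*}=G*\cdots*G$ denotes the $m$-fold convolution, i.e. the cumulative distribution function of the sum of $m$ independent random vectors each having cumulative distribution function $G$. The relation $\mathbf{x}\le\mathbf{b}$ is understood componentwise: $x_k\le b_k$ for $k=1,\dots,n$. *)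

theory Defs
  imports "HOL-Probability.Probability"
begin

text \<open>
  A vector with real coordinates indexed by a finite set \<open>J\<close> is a function in
  \<open>extensional J\<close>, and a distribution of such random vectors is a measure on the
  product space \<open>Pi\<^sub>M J (\<lambda>_. borel)\<close>. This allows the coordinate set to vary within
  a formula, as is needed for marginal distributions.
\<close>

definition pos_orthant :: "'i set \<Rightarrow> ('i \<Rightarrow> real) set" where
  "pos_orthant J = (\<Pi>\<^sub>E k\<in>J. {0<..})"

definition joint_cdf :: "'i set \<Rightarrow> ('i \<Rightarrow> real) measure \<Rightarrow> ('i \<Rightarrow> real) \<Rightarrow> real" where
  "joint_cdf J N x = measure N {y \<in> space N. \<forall>k\<in>J. y k \<le> x k}"

definition marginal_distr :: "'i set \<Rightarrow> ('i \<Rightarrow> real) measure \<Rightarrow> ('i \<Rightarrow> real) measure" where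
  "marginal_distr I N = distr N (Pi\<^sub>M I (\<lambda>_. borel)) (\<lambda>y. restrict y I)"

text \<open>
  The distribution of \<open>X\<^sub>1 + \<dots> + X\<^sub>m\<close> for independent random vectors \<open>X\<^sub>1, \<dots>, X\<^sub>m\<close> with
  common distribution \<open>N\<close>, realised as the coordinate projections of the \<open>m\<close>-fold
  product measure. For the cdf \<open>G\<close> of \<open>N\<close>, the convolution power \<open>G\<^sup>m\<^sup>*\<close> is the cdf of
  this measure.
\<close>

definition conv_power :: "'i set \<Rightarrow> nat \<Rightarrow> ('i \<Rightarrow> real) measure \<Rightarrow> ('i \<Rightarrow> real) measure" where
  "conv_power J m N =
     distr (Pi\<^sub>M {1..m} (\<lambda>_. N)) (Pi\<^sub>M J (\<lambda>_. borel)) (\<lambda>X. \<lambda>k\<in>J. \<Sum>j=1..m. X j k)"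

definition partial :: "'i \<Rightarrow> (('i \<Rightarrow> real) \<Rightarrow> real) \<Rightarrow> ('i \<Rightarrow> real) \<Rightarrow> real" where
  "partial i G x = deriv (\<lambda>t. G (x(i := t))) (x i)"

text \<open>
  \<open>C\<^sup>k\<close> on the open orthant: all iterated partial derivatives up to order \<open>k\<close> exist and
  are continuous. On \<open>pos_orthant J\<close> with \<open>J\<close> finite, the product topology of the function
  type is the Euclidean one, since the coordinates outside \<open>J\<close> are constant.
\<close>

primrec Ck_orthant :: "nat \<Rightarrow> 'i set \<Rightarrow> (('i \<Rightarrow> real) \<Rightarrow> real) \<Rightarrow> bool" where
  "Ck_orthant 0 J G \<longleftrightarrow> continuous_on (pos_orthant J) G"
| "Ck_orthant (Suc k) J G \<longleftrightarrow>
     continuous_on (pos_orthant J) G \<and>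
     (\<forall>i\<in>J. (\<forall>x\<in>pos_orthant J. (\<lambda>t. G (x(i := t))) differentiable at (x i)) \<and>
            Ck_orthant k J (partial i G))"

text \<open>
  Meant for \<open>F\<close> of class \<open>C\<^sup>2\<close>: then \<open>ln \<circ> F\<close> is \<open>C\<^sup>2\<close> as well, so the derivatives below
  exist.
\<close>

definition strict_MTP2 :: "'i set \<Rightarrow> (('i \<Rightarrow> real) \<Rightarrow> real) \<Rightarrow> bool" where
  "strict_MTP2 J F \<longleftrightarrow>
     (\<forall>x\<in>pos_orthant J. F x > 0) \<and>
     (\<forall>i\<in>J. \<forall>j\<in>J. i \<noteq> j \<longrightarrow>
        (\<forall>x\<in>pos_orthant J. partial j (partial i (\<lambda>y. ln (F y))) x > 0))"

end

theory Submission
  imports Defs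
begin

text \<open>
  Two facts combine. First, positivity of the mixed second derivatives of \<open>ln F\<close> means
  that an increment of \<open>ln F\<close> in the coordinates of \<open>I\<^sub>1\<close> grows when the coordinates of
  \<open>I\<^sub>2\<close> grow. Sending the latter to infinity turns \<open>F\<close> into the marginal \<open>F\<^sub>1\<close>, so
  \<open>F / F\<^sub>1\<close> decreases in the coordinates of \<open>I\<^sub>1\<close>; by symmetry \<open>F / F\<^sub>2\<close> decreases in those
  of \<open>I\<^sub>2\<close>. Hence \<open>r\<close> is strictly decreasing
  (\<open>cdf_ratio_strict_antimono\<close>), and since it tends to 1 at infinity it exceeds 1
  (\<open>cdf_ratio_gt_1\<close>). Writing \<open>c = r b\<close>, this says \<open>F > c F\<^sub>1 F\<^sub>2\<close> throughout the open box
  below \<open>b\<close>.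

  Second, such a lower bound for cdfs is preserved by convolution, with \<open>c\<close> raised to the
  corresponding power, because a sum of positive vectors lies below \<open>b\<close> only if every
  summand does. With \<open>F\<^sup>m\<^sup>*(z) > c\<^sup>m K(z)\<close> and \<open>K(z) = F\<^sub>1\<^sup>m\<^sup>*(z\<^sub>1) F\<^sub>2\<^sup>m\<^sup>*(z\<^sub>2)\<close>, the step from
  \<open>m\<close> to \<open>m + 1\<close> reads
    \<open>\<integral> F\<^sup>m\<^sup>*(z - y) dF(y) > c\<^sup>m \<integral> K(z - y) dF(y) = c\<^sup>m \<integral> F(z - s) dK(s)
      \<ge> c\<^sup>m\<^sup>+\<^sup>1 \<integral> F\<^sub>1(z\<^sub>1 - s\<^sub>1) F\<^sub>2(z\<^sub>2 - s\<^sub>2) dK(s)\<close>,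
  and the last integral factorises into the two marginal convolution powers
  (\<open>conv_power_less_Suc\<close>). The choice \<open>b = x\<close> gives the first half of the theorem, an
  arbitrary \<open>b\<close> the second.
\<close>

section \<open>Coordinates and the positive orthant\<close>

lemma joint_cdf_cong:
  "(\<And>k. k \<in> J \<Longrightarrow> x k = y k) \<Longrightarrow> joint_cdf J N x = joint_cdf J N y"
  unfolding joint_cdf_def by (metis (mono_tags, lifting))

lemma joint_cdf_restrict [simp]: "joint_cdf J N (restrict x J) = joint_cdf J N x"
  by (rule joint_cdf_cong) simp

lemma pos_orthant_upd: "x \<in> pos_orthant J \<Longrightarrow> i \<in> J \<Longrightarrow> 0 < t \<Longrightarrow> x(i := t) \<in> pos_orthant J"
  unfolding pos_orthant_def by (auto simp: PiE_def extensional_def Pi_def)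

lemma pos_orthantD: "x \<in> pos_orthant J \<Longrightarrow> k \<in> J \<Longrightarrow> 0 < x k"
  unfolding pos_orthant_def by (auto simp: PiE_def Pi_def)

lemma merge_pos_orthant:
  assumes "x \<in> pos_orthant (A \<union> B)" "y \<in> pos_orthant (A \<union> B)"
  shows "merge A B (x, y) \<in> pos_orthant (A \<union> B)"
  using assms unfolding pos_orthant_def by (auto simp: PiE_def extensional_def Pi_def merge_def)

lemma pos_orthant_eqI:
  "x \<in> pos_orthant J \<Longrightarrow> y \<in> pos_orthant J \<Longrightarrow> (\<And>k. k \<in> J \<Longrightarrow> x k = y k) \<Longrightarrow> x = y"
  unfolding pos_orthant_def by (rule PiE_ext)

section \<open>Mixed increments\<close>

lemma ln_partial_has_derivative:
  assumes C2: "Ck_orthant 2 J F" and mtp: "strict_MTP2 J F"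
    and x: "x \<in> pos_orthant J" and i: "i \<in> J"
  shows "((\<lambda>t. ln (F (x(i := t)))) has_real_derivative partial i F x / F x) (at (x i))"
    and "partial i (\<lambda>y. ln (F y)) x = partial i F x / F x"
proof -
  have "(\<lambda>t. F (x(i := t))) differentiable at (x i)"
    using C2 x i by (simp add: numeral_2_eq_2)
  then have *: "((\<lambda>t. F (x(i := t))) has_real_derivative partial i F x) (at (x i))"
    unfolding partial_def by (simp add: DERIV_deriv_iff_real_differentiable)
  have "F (x(i := x i)) > 0" using mtp x unfolding strict_MTP2_def by simp
  then show d: "((\<lambda>t. ln (F (x(i := t)))) has_real_derivative partial i F x / F x) (at (x i))"
    using DERIV_chain2[OF DERIV_ln_divide *] by simp
  show "partial i (\<lambda>y. ln (F y)) x = partial i F x / F x"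
    unfolding partial_def using DERIV_imp_deriv[OF d] by (simp add: partial_def)
qed

lemma ln_mixed_partial_has_derivative:
  assumes C2: "Ck_orthant 2 J F" and mtp: "strict_MTP2 J F"
    and x: "x \<in> pos_orthant J" and i: "i \<in> J" and j: "j \<in> J"
  shows "((\<lambda>t. partial i (\<lambda>y. ln (F y)) (x(j := t))) has_real_derivative
            partial j (partial i (\<lambda>y. ln (F y))) x) (at (x j))"
proof -
  have xj: "0 < x j" using x j by (rule pos_orthantD)
  have "(\<lambda>t. partial i F (x(j := t))) differentiable at (x j)"
       "(\<lambda>t. F (x(j := t))) differentiable at (x j)"
    using C2 x i j by (simp_all add: numeral_2_eq_2)
  then have "(\<lambda>t. partial i F (x(j := t)) / F (x(j := t))) differentiable at (x j)"
    using mtp x unfolding strict_MTP2_def by (auto intro!: differentiable_divide)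
  then obtain d where
    d: "((\<lambda>t. partial i F (x(j := t)) / F (x(j := t))) has_real_derivative d) (at (x j))"
    by (auto simp: real_differentiable_def)
  have "((\<lambda>t. partial i (\<lambda>y. ln (F y)) (x(j := t))) has_real_derivative d) (at (x j))"
    by (rule has_field_derivative_transform_within_open[OF d open_greaterThan, of 0])
      (use xj pos_orthant_upd[OF x j] ln_partial_has_derivative(2)[OF C2 mtp _ i] in auto)
  then show ?thesis
    unfolding partial_def[of j] using DERIV_imp_deriv by metis
qed

text \<open>
  The mixed derivative is integrated twice, as two applications of the fact that a positive
  derivative forces strict growth: along \<open>j\<close> for the \<open>i\<close>-derivative, then along \<open>i\<close> for the
  increment in \<open>j\<close>.
\<close>

lemma ln_mixed_increment_pos:
  assumes C2: "Ck_orthant 2 J F" and mtp: "strict_MTP2 J F"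
    and z: "z \<in> pos_orthant J" and ij: "i \<in> J" "j \<in> J" "i \<noteq> j"
    and s: "0 < s" "s < s'" and t: "0 < t" "t < t'"
  shows "ln (F (z(i := s, j := t'))) - ln (F (z(i := s, j := t)))
       < ln (F (z(i := s', j := t'))) - ln (F (z(i := s', j := t)))"
proof (rule DERIV_pos_imp_increasing[OF s(2)])
  fix a assume a: "s \<le> a" "a \<le> s'"
  let ?L = "\<lambda>y. ln (F y)"
  have orth: "z(i := a, j := c) \<in> pos_orthant J" if "0 < c" for c
    using that a s z ij by (intro pos_orthant_upd) auto
  have der: "((\<lambda>b. ?L (z(i := b, j := c))) has_real_derivative partial i ?L (z(i := a, j := c))) (at a)"
    if "0 < c" for c
    using ln_partial_has_derivative[OF C2 mtp orth[OF that] ij(1)] ij(3)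
    by (simp add: fun_upd_twist fun_upd_upd)
  have "partial i ?L (z(i := a, j := t)) < partial i ?L (z(i := a, j := t'))"
  proof (rule DERIV_pos_imp_increasing[OF t(2)])
    fix c assume c: "t \<le> c" "c \<le> t'"
    then have o: "z(i := a, j := c) \<in> pos_orthant J" using t by (intro orth) auto
    show "\<exists>d. ((\<lambda>c. partial i ?L (z(i := a, j := c))) has_real_derivative d) (at c) \<and> 0 < d"
      using ln_mixed_partial_has_derivative[OF C2 mtp o ij(1,2)] mtp o ij
      unfolding strict_MTP2_def by (auto)
  qed
  with DERIV_diff[OF der der] t
  show "\<exists>d. ((\<lambda>s. ?L (z(i := s, j := t')) - ?L (z(i := s, j := t))) has_real_derivative d) (at a) \<and> 0 < d"
    by (meson diff_gt_0_iff_gt less_trans)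
qed

text \<open>
  One passes from \<open>x\<close> to \<open>y\<close> by raising the coordinates one at a time; every intermediate
  point stays in the orthant.
\<close>

lemma pos_orthant_mono:
  fixes g :: "('i \<Rightarrow> real) \<Rightarrow> real"
  assumes J: "finite J" and x: "x \<in> pos_orthant J" and y: "y \<in> pos_orthant J"
    and le: "\<And>k. k \<in> J \<Longrightarrow> x k \<le> y k"
    and step: "\<And>z i t. z \<in> pos_orthant J \<Longrightarrow> i \<in> J \<Longrightarrow> z i \<le> t \<Longrightarrow> g z \<le> g (z(i := t))"
  shows "g x \<le> g y"
proof -
  have "override_on x y K \<in> pos_orthant J \<and> g x \<le> g (override_on x y K)" if "K \<subseteq> J" for K
    using finite_subset[OF that J] that
  proof (induction K)
    case empty
    then show ?case using x by simp
  next
    case (insert k K)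
    have "override_on x y (insert k K) = (override_on x y K)(k := y k)"
      by (auto simp: override_on_def)
    moreover have "override_on x y K k = x k" using insert.hyps by simp
    ultimately show ?case
      using insert step[of "override_on x y K" k "y k"] le[of k] pos_orthantD[OF y, of k]
        pos_orthant_upd[of "override_on x y K" J k "y k"] by (auto simp del: fun_upd_apply)
  qed
  from this[OF subset_refl] have "g x \<le> g (override_on x y J)" by simp
  also have "override_on x y J = y"
    using x y by (auto simp: override_on_def pos_orthant_def PiE_def extensional_def fun_eq_iff)
  finally show ?thesis .
qed

lemma ln_increment_mono:
  assumes C2: "Ck_orthant 2 J F" and mtp: "strict_MTP2 J F" and J: "finite J"
    and x: "x \<in> pos_orthant J" and y: "y \<in> pos_orthant J" and le: "\<And>k. k \<in> J \<Longrightarrow> x k \<le> y k"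
    and i: "i \<in> J" and s: "0 < s" "s \<le> s'"
  shows "ln (F (x(i := s'))) - ln (F (x(i := s))) \<le> ln (F (y(i := s'))) - ln (F (y(i := s)))"
proof (rule pos_orthant_mono[OF J x y le])
  fix z j t assume z: "z \<in> pos_orthant J" and j: "j \<in> J" and t: "z j \<le> t"
  show "ln (F (z(i := s'))) - ln (F (z(i := s)))
      \<le> ln (F ((z(j := t))(i := s'))) - ln (F ((z(j := t))(i := s)))"
  proof (cases "i = j \<or> s = s' \<or> z j = t")
    case True
    then show ?thesis by auto
  next
    case False
    then have "(z(j := t))(i := a) = z(i := a, j := t)" "z(i := a, j := z j) = z(i := a)" for a
      by (auto simp: fun_eq_iff)
    with False show ?thesis
      using ln_mixed_increment_pos[OF C2 mtp z i j, of s s' "z j" t] s t pos_orthantD[OF z j]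
      by simp
  qed
qed

text \<open>
  From a single coordinate to a block: for fixed \<open>x \<le> y\<close> the quantity
  \<open>ln (F (w \<oplus> y)) - ln (F (w \<oplus> x))\<close> is nondecreasing in each coordinate of \<open>w\<close> by
  \<open>ln_increment_mono\<close>, hence in \<open>w\<close>.
\<close>

lemma ln_block_increment_mono:
  assumes C2: "Ck_orthant 2 (A \<union> B) F" and mtp: "strict_MTP2 (A \<union> B) F"
    and fin: "finite A" "finite B"
    and orth: "u \<in> pos_orthant (A \<union> B)" "v \<in> pos_orthant (A \<union> B)"
              "x \<in> pos_orthant (A \<union> B)" "y \<in> pos_orthant (A \<union> B)"
    and uv: "\<And>k. k \<in> A \<Longrightarrow> u k \<le> v k" and xy: "\<And>k. k \<in> B \<Longrightarrow> x k \<le> y k"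
  shows "ln (F (merge A B (v, x))) - ln (F (merge A B (u, x)))
       \<le> ln (F (merge A B (v, y))) - ln (F (merge A B (u, y)))"
proof -
  let ?J = "A \<union> B"
  define g where "g w = ln (F (merge A B (w, y))) - ln (F (merge A B (w, x)))" for w
  have mg: "merge A B (w(i := t), z) = (if i \<in> A then (merge A B (w, z))(i := t) else merge A B (w, z))" 
    for w z :: "'a \<Rightarrow> real" and i t
    by (auto simp: merge_def)
  have "g (merge A B (u, x)) \<le> g (merge A B (v, x))"
  proof (rule pos_orthant_mono[of ?J _ _ g])
    fix w i t assume w: "w \<in> pos_orthant ?J" and i: "i \<in> ?J" and t: "w i \<le> t"
    show "g w \<le> g (w(i := t))"
    proof (cases "i \<in> A")
      case False
      then show ?thesis by (simp add: g_def mg)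
    next
      case True
      have "ln (F ((merge A B (w, x))(i := t))) - ln (F ((merge A B (w, x))(i := w i)))
          \<le> ln (F ((merge A B (w, y))(i := t))) - ln (F ((merge A B (w, y))(i := w i)))"
        by (rule ln_increment_mono[OF C2 mtp])
          (use fin w orth xy True t pos_orthantD[OF w i] merge_pos_orthant[of w A B] in
           \<open>auto simp: merge_def\<close>)
      moreover have "(merge A B (w, z))(i := w i) = merge A B (w, z)" for z
        using True by (auto simp: merge_def)
      ultimately show ?thesis using True by (simp add: g_def mg)
    qed
  next
    show "merge A B (u, x) k \<le> merge A B (v, x) k" for k
      using uv by (simp add: merge_def)
  qed (use fin orth in \<open>auto intro: merge_pos_orthant\<close>)
  moreover have "merge A B (merge A B (w, x), z) = merge A B (w, z)" for w z :: "'a \<Rightarrow> real"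
    by (auto simp: merge_def)
  ultimately show ?thesis by (simp add: g_def)
qed

text \<open>
  The rectangle \<open>[u, v] \<times> [x, y]\<close> is cut into three: one in which only a single coordinate
  of each block moves, where the gain is strict, and two others, where it is nonnegative.
\<close>

lemma ln_block_increment_strict_mono:
  assumes C2: "Ck_orthant 2 (A \<union> B) F" and mtp: "strict_MTP2 (A \<union> B) F"
    and fin: "finite A" "finite B" and dj: "A \<inter> B = {}" and ne: "A \<noteq> {}" "B \<noteq> {}"
    and orth: "u \<in> pos_orthant (A \<union> B)" "v \<in> pos_orthant (A \<union> B)"
              "x \<in> pos_orthant (A \<union> B)" "y \<in> pos_orthant (A \<union> B)"
    and uv: "\<And>k. k \<in> A \<Longrightarrow> u k < v k" and xy: "\<And>k. k \<in> B \<Longrightarrow> x k < y k"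
  shows "ln (F (merge A B (v, x))) - ln (F (merge A B (u, x)))
       < ln (F (merge A B (v, y))) - ln (F (merge A B (u, y)))"
proof -
  obtain i j where i: "i \<in> A" and j: "j \<in> B" using ne by blast
  have ij: "i \<noteq> j" using i j dj by blast
  define L where "L a b = ln (F (merge A B (a, b)))" for a b
  let ?u = "u(i := v i)" and ?x = "x(j := y j)"
  have o: "?u \<in> pos_orthant (A \<union> B)" "?x \<in> pos_orthant (A \<union> B)"
    using orth i j pos_orthantD[OF orth(2), of i] pos_orthantD[OF orth(4), of j]
    by (auto intro!: pos_orthant_upd)
  have ux: "merge A B (u, x) \<in> pos_orthant (A \<union> B)"
    using orth by (intro merge_pos_orthant)
  have eq: "(merge A B (u, x))(i := u i, j := x j) = merge A B (u, x)"
       "(merge A B (u, x))(i := u i, j := y j) = merge A B (u, ?x)"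
       "(merge A B (u, x))(i := v i, j := x j) = merge A B (?u, x)"
       "(merge A B (u, x))(i := v i, j := y j) = merge A B (?u, ?x)"
    using i j dj by (auto simp: merge_def fun_eq_iff)
  have "L u ?x - L u x < L ?u ?x - L ?u x"
    using ln_mixed_increment_pos[OF C2 mtp ux, of i j "u i" "v i" "x j" "y j"] i j ij uv[OF i] xy[OF j]
      pos_orthantD[OF orth(1), of i] pos_orthantD[OF orth(3), of j]
    unfolding eq L_def by auto
  moreover have "L ?u ?x - L u ?x \<le> L ?u y - L u y"
    unfolding L_def
    by (rule ln_block_increment_mono[OF C2 mtp fin orth(1) o orth(4)])
       (use i uv xy in \<open>auto simp: less_imp_le\<close>)
  moreover have "L v x - L ?u x \<le> L v y - L ?u y"
    unfolding L_def
    by (rule ln_block_increment_mono[OF C2 mtp fin o(1) orth(2,3,4)])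
       (use i uv xy in \<open>auto simp: less_imp_le\<close>)
  ultimately show ?thesis by (simp add: L_def)
qed

section \<open>The ratio of a cdf to the product of its marginals\<close>

lemma coordinate_measurable:
  assumes "sets M = sets (Pi\<^sub>M J (\<lambda>_. borel))" "k \<in> J"
  shows "(\<lambda>y. y k :: real) \<in> borel_measurable M"
  unfolding measurable_cong_sets[OF assms(1) refl] using assms(2) by simp

lemma lower_orthant_measurable:
  assumes "sets M = sets (Pi\<^sub>M J (\<lambda>_. borel))" "A \<subseteq> J" "finite A"
  shows "{y \<in> space M. \<forall>k\<in>A. y k \<le> (x k :: real)} \<in> sets M"
  using assms(2,3)
  by (auto intro!: sets.sets_Collect_finite_All borel_measurable_le coordinate_measurable[OF assms(1)])

text \<open>
  This lets the marginals be read off from \<open>M\<close> itself, so that all three cdfs in the ratio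
  are instances of \<open>joint_cdf\<close> for one measure.
\<close>

lemma joint_cdf_marginal [simp]:
  fixes M :: "('i \<Rightarrow> real) measure"
  assumes "sets M = sets (Pi\<^sub>M J (\<lambda>_. borel))" "A \<subseteq> J" "finite A"
  shows "joint_cdf A (marginal_distr A M) = joint_cdf A M"
proof
  fix x :: "'i \<Rightarrow> real"
  have rm: "(\<lambda>y. restrict y A) \<in> M \<rightarrow>\<^sub>M Pi\<^sub>M A (\<lambda>_. borel)"
    unfolding measurable_cong_sets[OF assms(1) refl] by (rule measurable_restrict_subset) fact
  have "{y \<in> space (Pi\<^sub>M A (\<lambda>_. borel)). \<forall>k\<in>A. y k \<le> x k} \<in> sets (Pi\<^sub>M A (\<lambda>_. borel))"
    using assms(3) by (intro lower_orthant_measurable[where J=A]) auto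
  then show "joint_cdf A (marginal_distr A M) x = joint_cdf A M x"
    unfolding joint_cdf_def marginal_distr_def
    using measurable_space[OF rm]
    by (simp add: measure_distr[OF rm]) (rule arg_cong[where f="measure M"], auto)
qed

lemma joint_cdf_tendsto_marginal:
  assumes M: "prob_space M" "sets M = sets (Pi\<^sub>M J (\<lambda>_. borel))"
    and AB: "finite A" "finite B" "A \<union> B \<subseteq> J" "A \<inter> B = {}"
  shows "(\<lambda>t. joint_cdf (A \<union> B) M (\<lambda>k. if k \<in> A then x k else w k + real t))
           \<longlonglongrightarrow> joint_cdf A M x"
proof -
  interpret prob_space M by fact
  let ?S = "\<lambda>t. {y \<in> space M. \<forall>k\<in>A\<union>B. y k \<le> (if k \<in> A then x k else w k + real t)}"
  have "range ?S \<subseteq> sets M"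
    using AB by (intro image_subsetI lower_orthant_measurable[OF M(2) AB(3)]) auto
  moreover have "incseq ?S"
    unfolding incseq_def
  proof (intro allI impI subsetI)
    fix a b y assume ab: "a \<le> b" and y: "y \<in> ?S a"
    have "w k + real a \<le> w k + real b" for k using ab by simp
    with y show "y \<in> ?S b" by (auto intro: order_trans)
  qed
  ultimately have "(\<lambda>t. measure M (?S t)) \<longlonglongrightarrow> measure M (\<Union>t. ?S t)"
    by (rule finite_Lim_measure_incseq)
  also have "(\<Union>t. ?S t) = {y \<in> space M. \<forall>k\<in>A. y k \<le> x k}"
  proof (intro equalityI subsetI)
    fix y assume y: "y \<in> {y \<in> space M. \<forall>k\<in>A. y k \<le> x k}"
    obtain t where t: "Max ((\<lambda>k. y k - w k) ` B) \<le> real t"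
      using real_arch_simple by blast
    have "y k \<le> w k + real t" if "k \<in> B" for k
    proof -
      have "y k - w k \<le> Max ((\<lambda>k. y k - w k) ` B)" using that AB by (intro Max_ge) auto
      with t show ?thesis by linarith
    qed
    then show "y \<in> (\<Union>t. ?S t)" using y by auto
  qed (use AB in \<open>auto split: if_splits\<close>)
  finally show ?thesis by (simp add: joint_cdf_def)
qed

lemma joint_cdf_shift_tendsto_1:
  assumes "prob_space M" "sets M = sets (Pi\<^sub>M J (\<lambda>_. borel))" "finite A" "A \<subseteq> J"
  shows "(\<lambda>t. joint_cdf A M (\<lambda>k. x k + real t)) \<longlonglongrightarrow> 1"
  using joint_cdf_tendsto_marginal[OF assms(1,2), of "{}" A undefined x] assms(3,4)
    prob_space.prob_space[OF assms(1)]
  by (simp add: joint_cdf_def)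

lemma joint_cdf_mono_set:
  assumes M: "prob_space M" "sets M = sets (Pi\<^sub>M J (\<lambda>_. borel))"
    and A: "A \<subseteq> J" "finite J"
  shows "joint_cdf J M x \<le> joint_cdf A M x"
proof -
  interpret prob_space M by fact
  show ?thesis
    unfolding joint_cdf_def
    by (rule finite_measure_mono)
       (use A lower_orthant_measurable[OF M(2) A(1) finite_subset[OF A]] in auto)
qed

text \<open>
  This is the statement that \<open>F / F\<^sub>A\<close> decreases in the coordinates of \<open>A\<close>, in cross-multiplied
  form. The quotient \<open>F (v \<oplus> x) / F (u \<oplus> x)\<close> grows when the coordinates of \<open>x\<close> in \<open>B\<close> are
  shifted up and tends to \<open>F\<^sub>A v / F\<^sub>A u\<close>. Strictness would be lost in the limit; it is
  secured by the first unit shift.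
\<close>

lemma joint_cdf_cross_less:
  assumes M: "prob_space M" "sets M = sets (Pi\<^sub>M (A \<union> B) (\<lambda>_. borel))"
    and C2: "Ck_orthant 2 (A \<union> B) (joint_cdf (A \<union> B) M)"
    and mtp: "strict_MTP2 (A \<union> B) (joint_cdf (A \<union> B) M)"
    and fin: "finite A" "finite B" and dj: "A \<inter> B = {}" and ne: "A \<noteq> {}" "B \<noteq> {}"
    and orth: "u \<in> pos_orthant (A \<union> B)" "v \<in> pos_orthant (A \<union> B)" "x \<in> pos_orthant (A \<union> B)"
    and uv: "\<And>k. k \<in> A \<Longrightarrow> u k < v k"
  shows "joint_cdf (A \<union> B) M (merge A B (v, x)) * joint_cdf A M u
       < joint_cdf (A \<union> B) M (merge A B (u, x)) * joint_cdf A M v"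
proof -
  let ?F = "joint_cdf (A \<union> B) M"
  define X where "X t = (\<lambda>k\<in>A\<union>B. x k + real t)" for t :: nat
  have X: "X t \<in> pos_orthant (A \<union> B)" for t
    using pos_orthantD[OF orth(3)] by (auto simp: X_def pos_orthant_def intro!: add_pos_nonneg)
  have X0: "X 0 = x"
    by (rule pos_orthant_eqI[OF X orth(3)]) (simp add: X_def)
  define \<rho> where "\<rho> t = ?F (merge A B (v, X t)) / ?F (merge A B (u, X t))" for t
  have pos: "0 < ?F (merge A B (w, X t))" if "w \<in> pos_orthant (A \<union> B)" for w t
    using mtp merge_pos_orthant[OF that X] unfolding strict_MTP2_def by auto
  have Fpos: "0 < ?F w" if "w \<in> pos_orthant (A \<union> B)" for w
    using mtp that unfolding strict_MTP2_def by auto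
  have Apos: "0 < joint_cdf A M w" if "w \<in> pos_orthant (A \<union> B)" for w
    using joint_cdf_mono_set[OF M, of A w] Fpos[OF that] fin by auto
  have ln\<rho>: "ln (\<rho> t) = ln (?F (merge A B (v, X t))) - ln (?F (merge A B (u, X t)))" 
    and \<rho>pos: "0 < \<rho> t" for t
    using pos[OF orth(1), of t] pos[OF orth(2), of t] by (simp_all add: \<rho>_def ln_div)
  have "ln (\<rho> 0) < ln (\<rho> 1)"
    unfolding ln\<rho>
    by (rule ln_block_increment_strict_mono[OF C2 mtp fin dj ne orth(1,2) X X uv])
       (auto simp: X_def)
  then have "\<rho> 0 < \<rho> 1" using \<rho>pos by simp
  moreover have "\<rho> 1 \<le> joint_cdf A M v / joint_cdf A M u"
  proof (rule LIMSEQ_le_const)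
    have eq: "?F (merge A B (w, X t)) = ?F (\<lambda>k. if k \<in> A then w k else x k + real t)" for w t
      by (rule joint_cdf_cong) (auto simp: X_def merge_def)
    show "\<rho> \<longlonglongrightarrow> joint_cdf A M v / joint_cdf A M u"
      unfolding \<rho>_def eq
      by (intro tendsto_divide joint_cdf_tendsto_marginal[OF M] fin dj)
         (use Apos[OF orth(1)] in auto)
    have "ln (\<rho> 1) \<le> ln (\<rho> t)" if "1 \<le> t" for t
      unfolding ln\<rho>
      by (rule ln_block_increment_mono[OF C2 mtp fin orth(1,2) X X])
         (use that uv in \<open>auto simp: X_def less_imp_le\<close>)
    then show "\<exists>N. \<forall>n\<ge>N. \<rho> 1 \<le> \<rho> n"
      using \<rho>pos by (meson ln_le_cancel_iff)
  qed
  ultimately have "\<rho> 0 < joint_cdf A M v / joint_cdf A M u" by simp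
  then show ?thesis
    using pos[OF orth(1), of 0] Apos[OF orth(1)] by (simp add: \<rho>_def X0 field_simps)
qed

text \<open>
  The two blocks are moved one after the other, through the intermediate point
  \<open>u\<^sub>A \<oplus> v\<^sub>B\<close>; in each move one of the two marginals stays constant.
\<close>

lemma cdf_ratio_strict_antimono:
  assumes M: "prob_space M" "sets M = sets (Pi\<^sub>M (A \<union> B) (\<lambda>_. borel))"
    and C2: "Ck_orthant 2 (A \<union> B) (joint_cdf (A \<union> B) M)"
    and mtp: "strict_MTP2 (A \<union> B) (joint_cdf (A \<union> B) M)"
    and fin: "finite A" "finite B" and dj: "A \<inter> B = {}" and ne: "A \<noteq> {}" "B \<noteq> {}"
    and orth: "u \<in> pos_orthant (A \<union> B)" "v \<in> pos_orthant (A \<union> B)"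
    and uv: "\<And>k. k \<in> A \<union> B \<Longrightarrow> u k < v k"
  shows "joint_cdf (A \<union> B) M v / (joint_cdf A M v * joint_cdf B M v)
       < joint_cdf (A \<union> B) M u / (joint_cdf A M u * joint_cdf B M u)"
proof -
  have Fpos: "0 < joint_cdf (A \<union> B) M w" if "w \<in> pos_orthant (A \<union> B)" for w
    using mtp that unfolding strict_MTP2_def by auto
  have Ap: "0 < joint_cdf A M w" "0 < joint_cdf B M w" if "w \<in> pos_orthant (A \<union> B)" for w
    using joint_cdf_mono_set[OF M, of A w] joint_cdf_mono_set[OF M, of B w] Fpos[OF that] fin by auto
  have id: "merge A B (w, w) = w" if "w \<in> pos_orthant (A \<union> B)" for w
    using that by (auto simp: merge_def pos_orthant_def PiE_def extensional_def)
  have com: "merge B A (w, z) = merge A B (z, w)" for w z :: "'a \<Rightarrow> real"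
    using dj by (auto simp: merge_def fun_eq_iff)
  have "joint_cdf (A \<union> B) M v * joint_cdf A M u
      < joint_cdf (A \<union> B) M (merge A B (u, v)) * joint_cdf A M v"
    using joint_cdf_cross_less[OF M C2 mtp fin dj ne orth(1,2,2) uv] by (simp add: id orth)
  moreover have "joint_cdf (A \<union> B) M (merge A B (u, v)) * joint_cdf B M u
      < joint_cdf (A \<union> B) M u * joint_cdf B M v"
    using joint_cdf_cross_less[of M B A u v u] M C2 mtp fin dj ne orth uv
    by (simp add: id com Un_commute Int_commute)
  ultimately have "joint_cdf (A \<union> B) M v / joint_cdf A M v
      < joint_cdf (A \<union> B) M (merge A B (u, v)) / joint_cdf A M u"
    "joint_cdf (A \<union> B) M (merge A B (u, v)) / joint_cdf B M v
      < joint_cdf (A \<union> B) M u / joint_cdf B M u"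
    using Ap orth by (simp_all add: field_simps)
  from divide_strict_right_mono[OF this(1) Ap(2)[OF orth(2)]]
       divide_strict_right_mono[OF this(2) Ap(1)[OF orth(1)]]
  show ?thesis by (simp add: mult.commute)
qed

lemma cdf_ratio_gt_1:
  assumes M: "prob_space M" "sets M = sets (Pi\<^sub>M (A \<union> B) (\<lambda>_. borel))"
    and C2: "Ck_orthant 2 (A \<union> B) (joint_cdf (A \<union> B) M)"
    and mtp: "strict_MTP2 (A \<union> B) (joint_cdf (A \<union> B) M)"
    and fin: "finite A" "finite B" and dj: "A \<inter> B = {}" and ne: "A \<noteq> {}" "B \<noteq> {}"
    and x: "x \<in> pos_orthant (A \<union> B)"
  shows "1 < joint_cdf (A \<union> B) M x / (joint_cdf A M x * joint_cdf B M x)"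
proof -
  define r where "r y = joint_cdf (A \<union> B) M y / (joint_cdf A M y * joint_cdf B M y)" for y
  define X where "X t = (\<lambda>k\<in>A\<union>B. x k + real t)" for t :: nat
  have X: "X t \<in> pos_orthant (A \<union> B)" for t
    using pos_orthantD[OF x] by (auto simp: X_def pos_orthant_def intro!: add_pos_nonneg)
  have X0: "X 0 = x"
    by (rule pos_orthant_eqI[OF X x]) (simp add: X_def)
  have dec: "r (X t) < r (X s)" if "s < t" for s t
    unfolding r_def
    by (rule cdf_ratio_strict_antimono[OF M C2 mtp fin dj ne X X]) (use that in \<open>auto simp: X_def\<close>)
  have eq: "joint_cdf C M (X t) = joint_cdf C M (\<lambda>k. x k + real t)" if "C \<subseteq> A \<union> B" for C t
    using that by (intro joint_cdf_cong) (auto simp: X_def)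
  have "(\<lambda>t. r (X t)) \<longlonglongrightarrow> 1 / (1 * 1)"
    unfolding r_def
    by (intro tendsto_intros) (simp_all add: eq joint_cdf_shift_tendsto_1[OF M] fin)
  then have "1 \<le> r (X 1)"
    using LIMSEQ_le_const2[of "\<lambda>t. r (X t)" 1 "r (X 1)"] dec
    by (metis div_by_1 le_less mult_1)
  with dec[of 0 1] X0 show ?thesis by (simp add: r_def)
qed


section \<open>Convolution powers\<close>

text \<open>
  With cdf values written as integrals of this indicator, conditioning and exchanging the
  order of summands become instances of Fubini's theorem for nonnegative integrands.
\<close>

definition le_ind :: "'i set \<Rightarrow> ('i \<Rightarrow> real) \<Rightarrow> ('i \<Rightarrow> real) \<Rightarrow> ennreal" where
  "le_ind A z y = (if \<forall>k\<in>A. y k \<le> z k then 1 else 0)"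

lemma le_ind_cong: "(\<And>k. k \<in> A \<Longrightarrow> x k = y k) \<Longrightarrow> le_ind A z x = le_ind A z y"
  by (simp add: le_ind_def)

lemma le_ind_measurable:
  assumes "finite A" "\<And>k. k \<in> A \<Longrightarrow> (\<lambda>x. w x k) \<in> borel_measurable N"
  shows "(\<lambda>x. le_ind A z (w x)) \<in> borel_measurable N"
  unfolding le_ind_def using assms
  by (intro measurable_If measurable_const) (auto intro!: sets.sets_Collect_finite_All borel_measurable_le)

lemma joint_cdf_diff_eq_nn_integral:
  assumes "prob_space N" "sets N = sets (Pi\<^sub>M J (\<lambda>_. borel))" "A \<subseteq> J" "finite A"
  shows "ennreal (joint_cdf A N (\<lambda>k. z k - s k)) = (\<integral>\<^sup>+y. le_ind A z (\<lambda>k. s k + y k) \<partial>N)"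
proof -
  interpret prob_space N by fact
  let ?S = "{y \<in> space N. \<forall>k\<in>A. y k \<le> z k - s k}"
  have "ennreal (joint_cdf A N (\<lambda>k. z k - s k)) = (\<integral>\<^sup>+y. indicator ?S y \<partial>N)"
    unfolding joint_cdf_def emeasure_eq_measure[symmetric]
    using lower_orthant_measurable[OF assms(2-4)] by simp
  also have "\<dots> = (\<integral>\<^sup>+y. le_ind A z (\<lambda>k. s k + y k) \<partial>N)"
    by (intro nn_integral_cong) (auto simp: le_ind_def indicator_def algebra_simps)
  finally show ?thesis .
qed

lemma joint_cdf_diff_measurable:
  assumes N: "prob_space N" "sets N = sets (Pi\<^sub>M J (\<lambda>_. borel))" "A \<subseteq> J" "finite A"
    and w: "\<And>k. k \<in> A \<Longrightarrow> (\<lambda>x. w x k) \<in> borel_measurable K"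
  shows "(\<lambda>x. ennreal (joint_cdf A N (\<lambda>k. z k - w x k))) \<in> borel_measurable K"
proof -
  interpret prob_space N by fact
  show ?thesis
    unfolding joint_cdf_diff_eq_nn_integral[OF N] split_beta'
    by (intro borel_measurable_nn_integral)
       (auto simp: split_beta' intro!: le_ind_measurable N(4) borel_measurable_add
          measurable_compose[OF measurable_fst w] measurable_compose[OF measurable_snd coordinate_measurable[OF N(2)]] subsetD[OF N(3)])
qed

lemma prob_space_marginal:
  assumes "prob_space M" "sets M = sets (Pi\<^sub>M J (\<lambda>_. borel))" "A \<subseteq> J"
  shows "prob_space (marginal_distr A M)"
  unfolding marginal_distr_def
  by (rule prob_space.prob_space_distr[OF assms(1)])
     (unfold measurable_cong_sets[OF assms(2) refl], rule measurable_restrict_subset, fact)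

lemma sets_marginal: "sets (marginal_distr A M) = sets (Pi\<^sub>M A (\<lambda>_. borel))"
  by (simp add: marginal_distr_def)

lemma AE_marginal_pos:
  assumes "prob_space M" "sets M = sets (Pi\<^sub>M J (\<lambda>_. borel))" "A \<subseteq> J" "finite A"
    and "AE x in M. \<forall>k\<in>J. 0 < x k"
  shows "AE x in marginal_distr A M. \<forall>k\<in>A. 0 < x k"
proof -
  have "(\<lambda>y. restrict y A) \<in> M \<rightarrow>\<^sub>M Pi\<^sub>M A (\<lambda>_. borel)"
    unfolding measurable_cong_sets[OF assms(2) refl] by (rule measurable_restrict_subset) fact
  moreover have "{x \<in> space (Pi\<^sub>M A (\<lambda>_. borel)). \<forall>k\<in>A. 0 < x k} \<in> sets (Pi\<^sub>M A (\<lambda>_. borel :: real measure))"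
    using assms(4)
    by (auto intro!: sets.sets_Collect_finite_All borel_measurable_less coordinate_measurable[OF refl])
  ultimately show ?thesis
    unfolding marginal_distr_def
    using assms(3,5) by (subst AE_distr_iff) auto
qed

lemma entry_measurable:
  assumes "sets N = sets (Pi\<^sub>M J (\<lambda>_. borel))" "j \<in> I" "k \<in> J"
  shows "(\<lambda>X. X j k :: real) \<in> borel_measurable (Pi\<^sub>M I (\<lambda>_. N))"
  by (rule measurable_compose[OF measurable_component_singleton coordinate_measurable]) fact+

lemma conv_power_measurable:
  assumes "sets N = sets (Pi\<^sub>M J (\<lambda>_. borel))"
  shows "(\<lambda>X. \<lambda>k\<in>J. \<Sum>j=1..m. X j k) \<in> Pi\<^sub>M {1..m} (\<lambda>_. N) \<rightarrow>\<^sub>M Pi\<^sub>M J (\<lambda>_. borel :: real measure)"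
  by (intro measurable_restrict borel_measurable_sum entry_measurable[OF assms])

lemma prob_space_conv_power:
  assumes "prob_space N" "sets N = sets (Pi\<^sub>M J (\<lambda>_. borel))"
  shows "prob_space (conv_power J m N)"
  unfolding conv_power_def
  by (intro prob_space.prob_space_distr conv_power_measurable assms prob_space_PiM)

lemma sets_conv_power: "sets (conv_power J m N) = sets (Pi\<^sub>M J (\<lambda>_. borel))"
  by (simp add: conv_power_def)

lemma AE_conv_power_pos:
  assumes N: "prob_space N" "sets N = sets (Pi\<^sub>M J (\<lambda>_. borel))" and J: "finite J"
    and pos: "AE x in N. \<forall>k\<in>J. 0 < x k" and m: "1 \<le> m"
  shows "AE s in conv_power J m N. \<forall>k\<in>J. 0 < s k"
proof -
  have "AE X in Pi\<^sub>M {1..m} (\<lambda>_. N). \<forall>j\<in>{1..m}. \<forall>k\<in>J. 0 < X j k"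
    by (rule AE_finite_allI) (auto intro!: AE_PiM_component[of "{1..m}" "\<lambda>_. N"] N pos)
  then have "AE X in Pi\<^sub>M {1..m} (\<lambda>_. N). \<forall>k\<in>J. 0 < (\<Sum>j=1..m. X j k)"
    by eventually_elim (use m in \<open>auto intro!: sum_pos\<close>)
  moreover have "{x \<in> space (Pi\<^sub>M J (\<lambda>_. borel)). \<forall>k\<in>J. 0 < x k} \<in> sets (Pi\<^sub>M J (\<lambda>_. borel :: real measure))"
    using J
    by (auto intro!: sets.sets_Collect_finite_All borel_measurable_less coordinate_measurable[OF refl])
  ultimately show ?thesis
    unfolding conv_power_def
    by (subst AE_distr_iff[OF conv_power_measurable[OF N(2)]]) auto
qed

lemma joint_cdf_nonpos:
  assumes "prob_space N" "AE x in N. \<forall>k\<in>J. 0 < x k" "k \<in> J" "z k \<le> 0"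
  shows "joint_cdf J N z = 0"
proof -
  have "AE x in N. \<not> (\<forall>k\<in>J. x k \<le> z k)"
    using assms(2) by eventually_elim (use assms(3,4) in force)
  then show ?thesis
    unfolding joint_cdf_def measure_def by (simp add: emeasure_eq_0_AE)
qed

lemma joint_cdf_conv_power_diff:
  assumes N: "prob_space N" "sets N = sets (Pi\<^sub>M J (\<lambda>_. borel))" and J: "finite J"
  shows "ennreal (joint_cdf J (conv_power J m N) (\<lambda>k. z k - s k))
       = (\<integral>\<^sup>+X. le_ind J z (\<lambda>k. s k + (\<Sum>j=1..m. X j k)) \<partial>Pi\<^sub>M {1..m} (\<lambda>_. N))"
proof -
  have "ennreal (joint_cdf J (conv_power J m N) (\<lambda>k. z k - s k))
      = (\<integral>\<^sup>+y. le_ind J z (\<lambda>k. s k + y k) \<partial>conv_power J m N)"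
    by (rule joint_cdf_diff_eq_nn_integral[OF prob_space_conv_power[OF N] sets_conv_power]) (use J in auto)
  also have "\<dots> = (\<integral>\<^sup>+X. le_ind J z (\<lambda>k. s k + (\<lambda>k\<in>J. \<Sum>j=1..m. X j k) k) \<partial>Pi\<^sub>M {1..m} (\<lambda>_. N))"
    unfolding conv_power_def
    by (rule nn_integral_distr[OF conv_power_measurable[OF N(2)]])
       (auto intro!: le_ind_measurable J borel_measurable_add coordinate_measurable[OF refl])
  also have "\<dots> = (\<integral>\<^sup>+X. le_ind J z (\<lambda>k. s k + (\<Sum>j=1..m. X j k)) \<partial>Pi\<^sub>M {1..m} (\<lambda>_. N))"
    by (intro nn_integral_cong le_ind_cong) simp
  finally show ?thesis .
qed

text \<open>
  The sum is conditioned either on its last summand or on the sum of the first \<open>m\<close>. Both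
  forms are needed: one exposes the \<open>m\<close>-fold power, to which an induction hypothesis
  applies, the other exposes the cdf of \<open>N\<close>.
\<close>

lemma joint_cdf_conv_power_Suc:
  assumes N: "prob_space N" "sets N = sets (Pi\<^sub>M J (\<lambda>_. borel))" and J: "finite J"
  shows "ennreal (joint_cdf J (conv_power J (Suc m) N) z)
       = (\<integral>\<^sup>+y. ennreal (joint_cdf J (conv_power J m N) (\<lambda>k. z k - y k)) \<partial>N)" (is ?A)
    and "ennreal (joint_cdf J (conv_power J (Suc m) N) z)
       = (\<integral>\<^sup>+s. ennreal (joint_cdf J N (\<lambda>k. z k - s k)) \<partial>conv_power J m N)" (is ?B)
proof -
  interpret N: prob_space N by fact
  interpret P: product_sigma_finite "\<lambda>_::nat. N" by standard
  let ?P = "\<lambda>m. Pi\<^sub>M {1..m} (\<lambda>_. N)"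
  have ins: "{1..Suc m} = insert (Suc m) {1..m}" by auto
  define f where "f X = le_ind J z (\<lambda>k. \<Sum>j=1..Suc m. X j k)" for X :: "nat \<Rightarrow> 'a \<Rightarrow> real"
  have f: "f \<in> borel_measurable (Pi\<^sub>M (insert (Suc m) {1..m}) (\<lambda>_. N))"
    unfolding f_def
    by (intro le_ind_measurable J borel_measurable_sum entry_measurable[OF N(2)]) auto
  have fup: "f (X(Suc m := y)) = le_ind J z (\<lambda>k. y k + (\<Sum>j=1..m. X j k))" for X y
    unfolding f_def by (intro le_ind_cong) (auto simp: sum.cl_ivl_Suc intro!: sum.cong)
  have start: "ennreal (joint_cdf J (conv_power J (Suc m) N) z) = (\<integral>\<^sup>+X. f X \<partial>?P (Suc m))"
    using joint_cdf_conv_power_diff[OF N J, of "Suc m" z "\<lambda>_. 0"] by (simp add: f_def)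
  show ?A
    unfolding start ins
    by (subst P.product_nn_integral_insert_rev[OF _ _ f])
       (simp_all add: fup joint_cdf_conv_power_diff[OF N J])
  have "(\<integral>\<^sup>+X. f X \<partial>?P (Suc m)) = (\<integral>\<^sup>+X. ennreal (joint_cdf J N (\<lambda>k. z k - (\<lambda>k\<in>J. \<Sum>j=1..m. X j k) k)) \<partial>?P m)"
    unfolding ins
  proof (subst P.product_nn_integral_insert[OF _ _ f])
    show "(\<integral>\<^sup>+X. \<integral>\<^sup>+y. f (X(Suc m := y)) \<partial>N \<partial>?P m)
        = (\<integral>\<^sup>+X. ennreal (joint_cdf J N (\<lambda>k. z k - (\<lambda>k\<in>J. \<Sum>j=1..m. X j k) k)) \<partial>?P m)"
      unfolding joint_cdf_diff_eq_nn_integral[OF N subset_refl J] fup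
      by (intro nn_integral_cong le_ind_cong) simp
  qed auto
  also have "\<dots> = (\<integral>\<^sup>+s. ennreal (joint_cdf J N (\<lambda>k. z k - s k)) \<partial>conv_power J m N)"
    unfolding conv_power_def
    by (rule nn_integral_distr[OF conv_power_measurable[OF N(2)], symmetric])
       (intro joint_cdf_diff_measurable[OF N subset_refl J] coordinate_measurable[OF sets_distr])
  finally show ?B using start by simp
qed

lemma joint_cdf_conv_power_1:
  assumes N: "prob_space N" "sets N = sets (Pi\<^sub>M J (\<lambda>_. borel))" and J: "finite J"
  shows "joint_cdf J (conv_power J 1 N) z = joint_cdf J N z"
proof -
  have "ennreal (joint_cdf J (conv_power J 1 N) z)
      = (\<integral>\<^sup>+y. le_ind J z y \<partial>N)"
    using joint_cdf_conv_power_Suc(1)[OF N J, of 0 z]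
    by (simp add: joint_cdf_conv_power_diff[OF N J] space_PiM_empty)
  also have "\<dots> = ennreal (joint_cdf J N z)"
    using joint_cdf_diff_eq_nn_integral[OF N subset_refl J, of z "\<lambda>_. 0"] by simp
  finally show ?thesis by (simp add: joint_cdf_def)
qed


section \<open>Comparing convolution powers\<close>

text \<open>
  Both sides are the probability that \<open>Y + (S \<oplus> T) \<le> z\<close> for independent \<open>Y\<close>, \<open>S\<close>, \<open>T\<close> with
  distributions \<open>M\<close>, \<open>K\<close>, \<open>L\<close>.
\<close>

lemma nn_integral_product_cdf_swap:
  assumes M: "prob_space M" "sets M = sets (Pi\<^sub>M (A \<union> B) (\<lambda>_. borel))"
    and fin: "finite A" "finite B" and dj: "A \<inter> B = {}"
    and K: "prob_space K" "sets K = sets (Pi\<^sub>M A (\<lambda>_. borel))"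
    and L: "prob_space L" "sets L = sets (Pi\<^sub>M B (\<lambda>_. borel))"
  shows "(\<integral>\<^sup>+y. ennreal (joint_cdf A K (\<lambda>k. z k - y k)) * ennreal (joint_cdf B L (\<lambda>k. z k - y k)) \<partial>M)
       = (\<integral>\<^sup>+s. \<integral>\<^sup>+t. ennreal (joint_cdf (A \<union> B) M (\<lambda>k. z k - merge A B (s, t) k)) \<partial>L \<partial>K)"
proof -
  interpret M: prob_space M by fact
  interpret K: prob_space K by fact
  interpret L: prob_space L by fact
  interpret KM: pair_sigma_finite K M ..
  interpret LM: pair_sigma_finite L M ..
  note mM = coordinate_measurable[OF M(2)]
  note mK = coordinate_measurable[OF K(2)]
  note mL = coordinate_measurable[OF L(2)]
  define f where "f y s = le_ind A z (\<lambda>k. y k + s k)" for y s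
  define g where "g y t = le_ind B z (\<lambda>k. y k + t k)" for y t
  have f [measurable]: "(\<lambda>x. f (p x) (q x)) \<in> borel_measurable X"
    if "p \<in> X \<rightarrow>\<^sub>M M" "q \<in> X \<rightarrow>\<^sub>M K" for p q and X :: "'x measure"
    unfolding f_def
    by (intro le_ind_measurable fin borel_measurable_add
         measurable_compose[OF that(1) mM] measurable_compose[OF that(2) mK]) auto
  have g [measurable]: "(\<lambda>x. g (p x) (q x)) \<in> borel_measurable X"
    if "p \<in> X \<rightarrow>\<^sub>M M" "q \<in> X \<rightarrow>\<^sub>M L" for p q and X :: "'x measure"
    unfolding g_def
    by (intro le_ind_measurable fin borel_measurable_add
         measurable_compose[OF that(1) mM] measurable_compose[OF that(2) mL]) auto
  have "(\<integral>\<^sup>+y. ennreal (joint_cdf A K (\<lambda>k. z k - y k)) * ennreal (joint_cdf B L (\<lambda>k. z k - y k)) \<partial>M)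
      = (\<integral>\<^sup>+y. (\<integral>\<^sup>+s. f y s \<partial>K) * (\<integral>\<^sup>+t. g y t \<partial>L) \<partial>M)"
    unfolding f_def g_def joint_cdf_diff_eq_nn_integral[OF K subset_refl fin(1)]
      joint_cdf_diff_eq_nn_integral[OF L subset_refl fin(2)] ..
  also have "\<dots> = (\<integral>\<^sup>+y. \<integral>\<^sup>+s. f y s * (\<integral>\<^sup>+t. g y t \<partial>L) \<partial>K \<partial>M)"
    by (intro nn_integral_cong nn_integral_multc[symmetric]) measurable
  also have "\<dots> = (\<integral>\<^sup>+y. \<integral>\<^sup>+s. \<integral>\<^sup>+t. f y s * g y t \<partial>L \<partial>K \<partial>M)"
    by (intro nn_integral_cong nn_integral_cmult[symmetric]) measurable
  also have "\<dots> = (\<integral>\<^sup>+s. \<integral>\<^sup>+y. \<integral>\<^sup>+t. f y s * g y t \<partial>L \<partial>M \<partial>K)"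
    by (rule KM.Fubini') measurable
  also have "\<dots> = (\<integral>\<^sup>+s. \<integral>\<^sup>+t. \<integral>\<^sup>+y. f y s * g y t \<partial>M \<partial>L \<partial>K)"
    by (intro nn_integral_cong LM.Fubini') measurable
  also have "\<dots> = (\<integral>\<^sup>+s. \<integral>\<^sup>+t. ennreal (joint_cdf (A \<union> B) M (\<lambda>k. z k - merge A B (s, t) k)) \<partial>L \<partial>K)"
  proof -
    have "f y s * g y t = le_ind (A \<union> B) z (\<lambda>k. merge A B (s, t) k + y k)" for y s t
      using dj by (auto simp: f_def g_def le_ind_def merge_def add.commute)
    then show ?thesis
      using joint_cdf_diff_eq_nn_integral[OF M subset_refl] fin by simp
  qed
  finally show ?thesis .
qed

text \<open>
  The bounds are assumed only strictly below \<open>b\<close>, yet the conclusion holds up to and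
  including \<open>b\<close>: subtracting an almost surely positive summand from \<open>z \<le> b\<close> leads strictly
  below \<open>b\<close>. Where the difference leaves the positive orthant, the product of the marginal
  cdfs vanishes and the comparison is trivial.
\<close>

lemma conv_power_less_Suc:
  assumes M: "prob_space M" "sets M = sets (Pi\<^sub>M (A \<union> B) (\<lambda>_. borel))"
    and fin: "finite A" "finite B" and dj: "A \<inter> B = {}"
    and supp: "AE x in M. \<forall>k\<in>A \<union> B. 0 < x k"
    and pos: "\<And>z. (\<And>k. k \<in> A \<union> B \<Longrightarrow> 0 < z k) \<Longrightarrow> 0 < joint_cdf (A \<union> B) M z"
    and c: "0 \<le> c"
    and base: "\<And>z. (\<And>k. k \<in> A \<union> B \<Longrightarrow> 0 < z k \<and> z k < b k) \<Longrightarrow>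
          c * (joint_cdf A M z * joint_cdf B M z) < joint_cdf (A \<union> B) M z"
    and m: "1 \<le> m"
    and IH: "\<And>z. (\<And>k. k \<in> A \<union> B \<Longrightarrow> 0 < z k \<and> z k < b k) \<Longrightarrow>
          c ^ m * (joint_cdf A (conv_power A m (marginal_distr A M)) z
                 * joint_cdf B (conv_power B m (marginal_distr B M)) z)
          < joint_cdf (A \<union> B) (conv_power (A \<union> B) m M) z"
    and z: "\<And>k. k \<in> A \<union> B \<Longrightarrow> 0 < z k \<and> z k \<le> b k"
  shows "c ^ Suc m * (joint_cdf A (conv_power A (Suc m) (marginal_distr A M)) z
                   * joint_cdf B (conv_power B (Suc m) (marginal_distr B M)) z)
       < joint_cdf (A \<union> B) (conv_power (A \<union> B) (Suc m) M) z"
proof -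
  let ?J = "A \<union> B"
  interpret M: prob_space M by fact
  have J: "finite ?J" using fin by simp
  note mA = prob_space_marginal[OF M Un_upper1] sets_marginal
  note mB = prob_space_marginal[OF M Un_upper2] sets_marginal
  note pA = AE_marginal_pos[OF M Un_upper1 fin(1) supp]
  note pB = AE_marginal_pos[OF M Un_upper2 fin(2) supp]
  define K where "K = conv_power A m (marginal_distr A M)"
  define L where "L = conv_power B m (marginal_distr B M)"
  define G where "G = conv_power ?J m M"
  have K: "prob_space K" "sets K = sets (Pi\<^sub>M A (\<lambda>_. borel))" "AE s in K. \<forall>k\<in>A. 0 < s k"
    unfolding K_def by (fact prob_space_conv_power[OF mA] sets_conv_power
      AE_conv_power_pos[OF mA fin(1) pA m])+
  have L: "prob_space L" "sets L = sets (Pi\<^sub>M B (\<lambda>_. borel))" "AE s in L. \<forall>k\<in>B. 0 < s k"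
    unfolding L_def by (fact prob_space_conv_power[OF mB] sets_conv_power
      AE_conv_power_pos[OF mB fin(2) pB m])+
  have G: "prob_space G" "sets G = sets (Pi\<^sub>M ?J (\<lambda>_. borel))"
    unfolding G_def by (fact prob_space_conv_power[OF M] sets_conv_power)+
  have eqA: "joint_cdf A (marginal_distr A M) = joint_cdf A M"
    and eqB: "joint_cdf B (marginal_distr B M) = joint_cdf B M"
    using M(2) fin by simp_all
  have nn: "0 \<le> joint_cdf X N w" for X :: "'a set" and N w by (simp add: joint_cdf_def)
  let ?a = "\<lambda>y. c ^ m * (joint_cdf A K (\<lambda>k. z k - y k) * joint_cdf B L (\<lambda>k. z k - y k))"
  let ?g = "\<lambda>y. joint_cdf ?J G (\<lambda>k. z k - y k)"
  have a_eq: "ennreal (?a y) = ennreal (c ^ m) * (ennreal (joint_cdf A K (\<lambda>k. z k - y k))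
        * ennreal (joint_cdf B L (\<lambda>k. z k - y k)))" for y
    using c by (simp add: ennreal_mult nn)
  have Km: "(\<lambda>y. ennreal (joint_cdf A K (\<lambda>k. z k - y k))) \<in> borel_measurable M"
    by (rule joint_cdf_diff_measurable[OF K(1,2) subset_refl fin(1)])
       (auto intro: coordinate_measurable[OF M(2)])
  have Lm: "(\<lambda>y. ennreal (joint_cdf B L (\<lambda>k. z k - y k))) \<in> borel_measurable M"
    by (rule joint_cdf_diff_measurable[OF L(1,2) subset_refl fin(2)])
       (auto intro: coordinate_measurable[OF M(2)])
  have Gm: "(\<lambda>y. ennreal (?g y)) \<in> borel_measurable M"
    by (rule joint_cdf_diff_measurable[OF G subset_refl J])
       (auto intro: coordinate_measurable[OF M(2)])
  have am: "(\<lambda>y. ennreal (?a y)) \<in> borel_measurable M"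
    unfolding a_eq using Km Lm by measurable
  have g_int: "(\<integral>\<^sup>+y. ennreal (?g y) \<partial>M) = ennreal (joint_cdf ?J (conv_power ?J (Suc m) M) z)"
    unfolding G_def by (rule joint_cdf_conv_power_Suc(1)[OF M J, symmetric])
  have lt: "?a y < ?g y" if "\<forall>k\<in>?J. 0 < y k" "\<forall>k\<in>?J. y k < z k" for y
    unfolding K_def L_def G_def
    by (rule IH) (use that z in force)
  have le: "?a y \<le> ?g y" if y: "\<forall>k\<in>?J. 0 < y k" for y
  proof (cases "\<forall>k\<in>?J. y k < z k")
    case True
    then show ?thesis using lt[OF y] by simp
  next
    case False
    then obtain k where k: "k \<in> A \<or> k \<in> B" "z k - y k \<le> 0" by force
    then have "?a y = 0"
      using joint_cdf_nonpos[OF K(1,3)] joint_cdf_nonpos[OF L(1,3)] by fastforce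
    then show ?thesis by (rule ord_eq_le_trans[OF _ nn])
  qed
  have AEle: "AE y in M. ennreal (?a y) \<le> ennreal (?g y)"
    using supp by eventually_elim (intro ennreal_leI le)
  have "(\<integral>\<^sup>+y. ennreal (?a y) \<partial>M) < (\<integral>\<^sup>+y. ennreal (?g y) \<partial>M)"
  proof (rule nn_integral_less[OF am Gm _ AEle])
    show "(\<integral>\<^sup>+y. ennreal (?a y) \<partial>M) \<noteq> \<infinity>"
      using nn_integral_mono_AE[OF AEle] unfolding g_int by (auto simp: top_unique)
    \<comment> \<open>The inequality is strict on the box below \<open>z / 2\<close>, which has positive mass.\<close>
    show "\<not> (AE y in M. ennreal (?g y) \<le> ennreal (?a y))"
    proof
      assume "AE y in M. ennreal (?g y) \<le> ennreal (?a y)"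
      with supp have "AE y in M. \<not> (\<forall>k\<in>?J. y k \<le> z k / 2)"
      proof eventually_elim
        case (elim y)
        show ?case
        proof
          assume h: "\<forall>k\<in>?J. y k \<le> z k / 2"
          have "\<forall>k\<in>?J. y k < z k" using h z by force
          from lt[OF elim(1) this] elim(2) show False
            using c nn by (simp add: ennreal_le_iff)
        qed
      qed
      then have "joint_cdf ?J M (\<lambda>k. z k / 2) = 0"
        unfolding joint_cdf_def measure_def by (simp add: emeasure_eq_0_AE)
      with pos[of "\<lambda>k. z k / 2"] z show False by simp
    qed
  qed
  moreover have "ennreal (c ^ Suc m * (joint_cdf A (conv_power A (Suc m) (marginal_distr A M)) z
                   * joint_cdf B (conv_power B (Suc m) (marginal_distr B M)) z))
      \<le> (\<integral>\<^sup>+y. ennreal (?a y) \<partial>M)"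
  proof -
    let ?FA = "\<lambda>s. ennreal (joint_cdf A M (\<lambda>k. z k - s k))"
    let ?FB = "\<lambda>t. ennreal (joint_cdf B M (\<lambda>k. z k - t k))"
    have mA': "?FA \<in> borel_measurable K"
      by (rule joint_cdf_diff_measurable[OF M _ fin(1)])
         (auto intro: coordinate_measurable[OF K(2)])
    have mB': "?FB \<in> borel_measurable L"
      by (rule joint_cdf_diff_measurable[OF M _ fin(2)])
         (auto intro: coordinate_measurable[OF L(2)])
    have bound: "ennreal c * (?FA s * ?FB t)
        \<le> ennreal (joint_cdf ?J M (\<lambda>k. z k - merge A B (s, t) k))"
      if s: "\<forall>k\<in>A. 0 < s k" and t: "\<forall>k\<in>B. 0 < t k" for s t
    proof -
      let ?w = "\<lambda>k. z k - merge A B (s, t) k"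
      have "joint_cdf A M (\<lambda>k. z k - s k) = joint_cdf A M ?w"
        "joint_cdf B M (\<lambda>k. z k - t k) = joint_cdf B M ?w"
        using dj by (auto intro!: joint_cdf_cong simp: merge_def)
      moreover have "c * (joint_cdf A M ?w * joint_cdf B M ?w) \<le> joint_cdf ?J M ?w"
      proof (cases "\<forall>k\<in>?J. 0 < ?w k")
        case True
        have "?w k < b k" if "k \<in> ?J" for k
          using that z[OF that] s t by (force simp: merge_def)
        with True show ?thesis by (intro less_imp_le base) auto
      next
        case False
        then obtain k where k: "k \<in> A \<or> k \<in> B" "?w k \<le> 0" by force
        then have "c * (joint_cdf A M ?w * joint_cdf B M ?w) = 0"
          using joint_cdf_nonpos[OF mA(1) pA, of k ?w] joint_cdf_nonpos[OF mB(1) pB, of k ?w]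
          unfolding eqA eqB by auto
        then show ?thesis by (rule ord_eq_le_trans[OF _ nn])
      qed
      ultimately show ?thesis
        using c by (simp add: nn flip: ennreal_mult)
    qed
    have "ennreal (c ^ Suc m * (joint_cdf A (conv_power A (Suc m) (marginal_distr A M)) z
                   * joint_cdf B (conv_power B (Suc m) (marginal_distr B M)) z))
        = ennreal (c ^ m) * (ennreal c * ((\<integral>\<^sup>+s. ?FA s \<partial>K) * (\<integral>\<^sup>+t. ?FB t \<partial>L)))"
      using joint_cdf_conv_power_Suc(2)[OF mA fin(1), of m z]
        joint_cdf_conv_power_Suc(2)[OF mB fin(2), of m z] c
      by (simp add: eqA eqB K_def L_def ennreal_mult nn mult_ac)
    also have "\<dots> = ennreal (c ^ m) * (\<integral>\<^sup>+s. \<integral>\<^sup>+t. ennreal c * (?FA s * ?FB t) \<partial>L \<partial>K)"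
      using mA' mB' by (simp add: nn_integral_cmult nn_integral_multc)
    also have "\<dots> \<le> ennreal (c ^ m) *
        (\<integral>\<^sup>+s. \<integral>\<^sup>+t. ennreal (joint_cdf ?J M (\<lambda>k. z k - merge A B (s, t) k)) \<partial>L \<partial>K)"
    proof (intro mult_left_mono nn_integral_mono_AE)
      show "AE s in K. (\<integral>\<^sup>+t. ennreal c * (?FA s * ?FB t) \<partial>L)
          \<le> (\<integral>\<^sup>+t. ennreal (joint_cdf ?J M (\<lambda>k. z k - merge A B (s, t) k)) \<partial>L)"
        using K(3)
      proof eventually_elim
        case (elim s)
        show ?case
          by (rule nn_integral_mono_AE, use L(3) in eventually_elim) (rule bound[OF elim])
      qed
    qed simp
    also have "\<dots> = (\<integral>\<^sup>+y. ennreal (?a y) \<partial>M)"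
      unfolding nn_integral_product_cdf_swap[OF M fin dj K(1,2) L(1,2), symmetric] a_eq
      by (rule nn_integral_cmult[symmetric]) (use Km Lm in measurable)
    finally show ?thesis .
  qed
  ultimately show ?thesis
    unfolding g_int using c by (auto simp: ennreal_less_iff nn dest: le_less_trans)
qed

text \<open>
  For \<open>m = 1\<close> the bound holds only strictly below \<open>b\<close>, since there is equality at \<open>b\<close> when
  \<open>c = r b\<close>. The induction is therefore carried out on the open box, and the last
  convolution step extends the bound to the closed one; this is where \<open>m \<ge> 2\<close> enters.
\<close>

lemma conv_power_less:
  assumes M: "prob_space M" "sets M = sets (Pi\<^sub>M (A \<union> B) (\<lambda>_. borel))"
    and fin: "finite A" "finite B" and dj: "A \<inter> B = {}"
    and supp: "AE x in M. \<forall>k\<in>A \<union> B. 0 < x k"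
    and pos: "\<And>z. (\<And>k. k \<in> A \<union> B \<Longrightarrow> 0 < z k) \<Longrightarrow> 0 < joint_cdf (A \<union> B) M z"
    and c: "0 \<le> c"
    and base: "\<And>z. (\<And>k. k \<in> A \<union> B \<Longrightarrow> 0 < z k \<and> z k < b k) \<Longrightarrow>
          c * (joint_cdf A M z * joint_cdf B M z) < joint_cdf (A \<union> B) M z"
    and m: "2 \<le> m"
    and z: "\<And>k. k \<in> A \<union> B \<Longrightarrow> 0 < z k \<and> z k \<le> b k"
  shows "c ^ m * (joint_cdf A (conv_power A m (marginal_distr A M)) z
                   * joint_cdf B (conv_power B m (marginal_distr B M)) z)
       < joint_cdf (A \<union> B) (conv_power (A \<union> B) m M) z"
proof -
  have below: "c ^ m * (joint_cdf A (conv_power A m (marginal_distr A M)) z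
                   * joint_cdf B (conv_power B m (marginal_distr B M)) z)
       < joint_cdf (A \<union> B) (conv_power (A \<union> B) m M) z"
    if "1 \<le> m" "\<And>k. k \<in> A \<union> B \<Longrightarrow> 0 < z k \<and> z k < b k" for m z
    using that
  proof (induction m arbitrary: z rule: nat_induct_at_least)
    case base
    show ?case
      using assms(9)[OF base]
        joint_cdf_conv_power_1[OF prob_space_marginal[OF M Un_upper1] sets_marginal fin(1)]
        joint_cdf_conv_power_1[OF prob_space_marginal[OF M Un_upper2] sets_marginal fin(2)]
        joint_cdf_conv_power_1[OF M finite_UnI[OF fin]] M(2) fin
      by simp
  next
    case (Suc m)
    show ?case
      by (rule conv_power_less_Suc[OF M fin dj supp pos c assms(9) Suc(1) Suc(2)])
         (use Suc.prems in force)+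
  qed
  obtain m' where m': "m = Suc m'" "1 \<le> m'" using m by (cases m) auto
  show ?thesis
    unfolding m'(1)
    by (rule conv_power_less_Suc[OF M fin dj supp pos c assms(9) m'(2) below[OF m'(2)] z]) auto
qed

theorem mainTheorem1:
  fixes n :: nat
    and M :: "(nat \<Rightarrow> real) measure"
    and F F\<^sub>1 F\<^sub>2 f r :: "(nat \<Rightarrow> real) \<Rightarrow> real"
    and I\<^sub>1 I\<^sub>2 :: "nat set"
  assumes n: "n \<ge> 2"
    and prob: "prob_space M"
    and sets_M: "sets M = sets (Pi\<^sub>M {1..n} (\<lambda>_. borel))"
    and supp: "AE x in M. x \<in> pos_orthant {1..n}"
    and F: "F = joint_cdf {1..n} M"
    and C2: "Ck_orthant 2 {1..n} F"
    and mtp: "strict_MTP2 {1..n} F"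
    and f_meas: "f \<in> borel_measurable (Pi\<^sub>M {1..n} (\<lambda>_. lborel))"
    and f_dens: "M = density (Pi\<^sub>M {1..n} (\<lambda>_. lborel)) (\<lambda>x. ennreal (f x))"
    and f_pos: "\<forall>x\<in>pos_orthant {1..n}. f x > 0"
    and I1: "I\<^sub>1 \<noteq> {}" "I\<^sub>1 \<subset> {1..n}"
    and I2: "I\<^sub>2 = {1..n} - I\<^sub>1"
    and F1: "F\<^sub>1 = joint_cdf I\<^sub>1 (marginal_distr I\<^sub>1 M)"
    and F2: "F\<^sub>2 = joint_cdf I\<^sub>2 (marginal_distr I\<^sub>2 M)"
    and r: "r = (\<lambda>x. F x / (F\<^sub>1 (restrict x I\<^sub>1) * F\<^sub>2 (restrict x I\<^sub>2)))"
  shows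
    "(\<forall>m\<ge>2. \<forall>x\<in>pos_orthant {1..n}.
        joint_cdf {1..n} (conv_power {1..n} m M) x
          > r x ^ m * joint_cdf I\<^sub>1 (conv_power I\<^sub>1 m (marginal_distr I\<^sub>1 M)) (restrict x I\<^sub>1)
                   * joint_cdf I\<^sub>2 (conv_power I\<^sub>2 m (marginal_distr I\<^sub>2 M)) (restrict x I\<^sub>2)
        \<and> r x > 1) \<and>
     (\<forall>b\<in>pos_orthant {1..n}. \<forall>m\<ge>2. \<forall>x\<in>pos_orthant {1..n}. (\<forall>k\<in>{1..n}. x k \<le> b k) \<longrightarrow>
        joint_cdf {1..n} (conv_power {1..n} m M) x
          > r b ^ m * joint_cdf I\<^sub>1 (conv_power I\<^sub>1 m (marginal_distr I\<^sub>1 M)) (restrict x I\<^sub>1)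
                   * joint_cdf I\<^sub>2 (conv_power I\<^sub>2 m (marginal_distr I\<^sub>2 M)) (restrict x I\<^sub>2))"
proof -
  let ?J = "{1..n}"
  have J: "?J = I\<^sub>1 \<union> I\<^sub>2" using I1 I2 by auto
  have fin: "finite I\<^sub>1" "finite I\<^sub>2" using I1 I2 finite_subset[of _ ?J] by auto
  have dj: "I\<^sub>1 \<inter> I\<^sub>2 = {}" and ne: "I\<^sub>2 \<noteq> {}" using I1 I2 by auto
  note M = prob sets_M[unfolded J]
  note C2' = C2[unfolded F J] and mtp' = mtp[unfolded F J]
  have supp': "AE x in M. \<forall>k\<in>I\<^sub>1 \<union> I\<^sub>2. 0 < x k"
    using supp unfolding J by eventually_elim (auto dest: pos_orthantD)
  have r_eq: "r x = joint_cdf (I\<^sub>1 \<union> I\<^sub>2) M x / (joint_cdf I\<^sub>1 M x * joint_cdf I\<^sub>2 M x)" for x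
    unfolding r F F1 F2 J using fin M(2) by simp
  have r_gt: "1 < r x" if "x \<in> pos_orthant ?J" for x
    unfolding r_eq by (rule cdf_ratio_gt_1[OF M C2' mtp' fin dj I1(1) ne]) (use that J in simp)
  have cdf_pos: "0 < joint_cdf (I\<^sub>1 \<union> I\<^sub>2) M z" if "\<And>k. k \<in> I\<^sub>1 \<union> I\<^sub>2 \<Longrightarrow> 0 < z k" for z
  proof -
    have "restrict z (I\<^sub>1 \<union> I\<^sub>2) \<in> pos_orthant (I\<^sub>1 \<union> I\<^sub>2)"
      using that by (auto simp: pos_orthant_def)
    then show ?thesis using mtp' unfolding strict_MTP2_def by fastforce
  qed
  have bound: "r b ^ m * joint_cdf I\<^sub>1 (conv_power I\<^sub>1 m (marginal_distr I\<^sub>1 M)) (restrict x I\<^sub>1)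
                   * joint_cdf I\<^sub>2 (conv_power I\<^sub>2 m (marginal_distr I\<^sub>2 M)) (restrict x I\<^sub>2)
             < joint_cdf ?J (conv_power ?J m M) x"
    if b: "b \<in> pos_orthant ?J" and x: "x \<in> pos_orthant ?J" and m: "2 \<le> m"
      and le: "\<forall>k\<in>?J. x k \<le> b k" for b x m
  proof -
    have base: "r b * (joint_cdf I\<^sub>1 M z * joint_cdf I\<^sub>2 M z) < joint_cdf (I\<^sub>1 \<union> I\<^sub>2) M z"
      if z: "\<And>k. k \<in> I\<^sub>1 \<union> I\<^sub>2 \<Longrightarrow> 0 < z k \<and> z k < b k" for z
    proof -
      let ?z = "restrict z (I\<^sub>1 \<union> I\<^sub>2)"
      have oz: "?z \<in> pos_orthant (I\<^sub>1 \<union> I\<^sub>2)" using z by (auto simp: pos_orthant_def)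
      have eq: "joint_cdf I\<^sub>1 M ?z = joint_cdf I\<^sub>1 M z" "joint_cdf I\<^sub>2 M ?z = joint_cdf I\<^sub>2 M z"
        by (auto intro: joint_cdf_cong)
      have "r b < joint_cdf (I\<^sub>1 \<union> I\<^sub>2) M z / (joint_cdf I\<^sub>1 M z * joint_cdf I\<^sub>2 M z)"
        using cdf_ratio_strict_antimono[OF M C2' mtp' fin dj I1(1) ne oz b[unfolded J]] z
        unfolding r_eq eq by simp
      moreover have "0 < joint_cdf (I\<^sub>1 \<union> I\<^sub>2) M z" using cdf_pos z by blast
      then have "0 < joint_cdf I\<^sub>1 M z * joint_cdf I\<^sub>2 M z"
        using joint_cdf_mono_set[OF M, of I\<^sub>1 z] joint_cdf_mono_set[OF M, of I\<^sub>2 z] fin by auto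
      ultimately show ?thesis by (simp add: pos_less_divide_eq)
    qed
    have "r b ^ m * (joint_cdf I\<^sub>1 (conv_power I\<^sub>1 m (marginal_distr I\<^sub>1 M)) x
                   * joint_cdf I\<^sub>2 (conv_power I\<^sub>2 m (marginal_distr I\<^sub>2 M)) x)
             < joint_cdf (I\<^sub>1 \<union> I\<^sub>2) (conv_power (I\<^sub>1 \<union> I\<^sub>2) m M) x"
      by (rule conv_power_less[where b = b, OF M fin dj supp' cdf_pos _ base m])
         (use r_gt[OF b] pos_orthantD[OF x[unfolded J]] le[unfolded J] in auto)
    then show ?thesis unfolding J by (simp add: mult.assoc)
  qed
  show ?thesis using bound r_gt by blast
qed

end
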